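(* Let $n\ge1$, $f:\mathbb{R}^n\to\mathbb{R}\cup\{+\infty\}$, $r>0$, and let $\mathbb{O}$ be a covering oracle of radius $r$. Consider any run of the covering direct search method (cDSM, defined in the context) on $f$ with covering radius $r$ whose covering step uses $$\mathcal{D}_C^k=\mathrm{round}\big(\mathbb{O}(x^k,\mathcal{H}^k),\,\mathcal{M}(\underline{\delta}^k)\big)\qquad\text{for all } k\in\mathbb{N}.$$ Then the run satisfies the dense covering property: $\mathcal{B}_r(x^* )\subseteq\mathrm{cl}(\mathcal{H})$ for every refined point $x^*\in\mathcal{R}$.
   Context: Notation: $X=\{x\in\mathbb{R}^n:f(x)\neq+\infty\}$; $\mathcal{B}_r(x)$ is the open ball of radius $r$ centered at $x$ (for a fixed norm $\|\cdot\|$ on $\mathbb{R}^n$), $\mathcal{B}_r=\mathcal{B}_r(0)$, $\mathrm{cl}$ is closure, $\{x\}+S=\{x+s:s\in S\}$, $\mathrm{dist}(x,S)=\inf\{\|x-s\|:s\in S\}$, and "$t\in\operatorname{argmin} f(S)$" means that $t$ minimizes $f$ over $S$. For $S$ nonempty and closed, $\mathrm{round}(x,S)$ is the set of points of $S$ nearest to $x$, and $\mathrm{round}(A,S)=\bigcup_{a\in A}\mathrm{round}(a,S)$ for $A\subseteq\mathbb{R}^n$. A positive basis of $\mathbb{R}^n$ is a minimal set whose nonnegative linear combinations give all of $\mathbb{R}^n$. Covering oracle: for $r>0$, a function $\mathbb{O}:\mathbb{R}^n\times 2^{\mathbb{R}^n}\to 2^{\mathbb{R}^n}$ is a covering oracle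 of radius $r$ if there is $\beta\in{]0,1]}$ such that, for all $x\in\mathbb{R}^n$ and all nonempty $S\subseteq\mathbb{R}^n$, the set $\mathbb{O}(x,S)$ is compact, $\emptyset\ne\mathbb{O}(x,S)\subseteq\mathrm{cl}(\mathcal{B}_r)$, and $$\max_{d\in\mathbb{O}(x,S)}\mathrm{dist}(x+d,S)\ \ge\ \beta\max_{d\in\mathrm{cl}(\mathcal{B}_r)}\mathrm{dist}(x+d,S).$$ The cDSM (with the covering set $\mathcal{D}_C^k$ prescribed as in the claim). Initialization: covering radius $r>0$; $\mathcal{H}^0=\emptyset$; $x^0\in X$, $\delta^0>0$, $\underline{\delta}^0=\delta^0$; $\tau\in{]0,1[}\cap\mathbb{Q}$; and choose $\mathcal{M}:\mathbb{R}_+\to 2^{\mathbb{R}^n}$ and $\rho:\mathbb{R}_+\to\mathbb{R}_+$ according to one of the two options: (mesh-based) $\mathcal{M}(\nu)=\min\{\nu,\nu^2/\delta^0\}\,\mathbb{Z}^n$ and $\rho(\nu)=0$ for all $\nu$; (sufficient decrease-based) $\mathcal{M}(\nu)=\mathbb{R}^n$ and $\rho(\nu)=\min\{\nu,\nu^2/\delta^0\}$ for all $\nu$. For each $k=0,1,2,\dots$: - Covering step: take $\mathcal{D}_C^k$ as prescribed; $\mathcal{T}_C^k=\{x^k\}+\mathcal{D}_C^k$; choose $t_C^k\in\operatorname{argmin} f(\mathcal{T}_C^k)$. If $f(t_C^k)<f(x^k)-\rho(\underline{\delta}^k)$, set $t^k=t_C^k$, $\mathcal{T}_S^k=\mathcal{T}_P^k=\emptyset$,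 and go to the update step. - Search step: choose $\mathcal{D}_S^k\subseteq\mathcal{M}(\underline{\delta}^k)$ empty or finite; $\mathcal{T}_S^k=\{x^k\}+\mathcal{D}_S^k$. If $\mathcal{T}_S^k\neq\emptyset$, choose $t_S^k\in\operatorname{argmin} f(\mathcal{T}_S^k)$; if also $f(t_S^k)<f(x^k)-\rho(\underline{\delta}^k)$, set $t^k=t_S^k$, $\mathcal{T}_P^k=\emptyset$, and go to the update step. - Poll step: choose $\mathcal{D}_P^k\subseteq\mathcal{M}(\underline{\delta}^k)\cap\mathrm{cl}(\mathcal{B}_{\delta^k})$ a positive basis of $\mathbb{R}^n$; $\mathcal{T}_P^k=\{x^k\}+\mathcal{D}_P^k$; choose $t_P^k\in\operatorname{argmin} f(\mathcal{T}_P^k)$. If $f(t_P^k)<f(x^k)-\rho(\underline{\delta}^k)$ set $t^k=t_P^k$, otherwise set $t^k=x^k$. - Update step: $\mathcal{T}^k=\mathcal{T}_C^k\cup\mathcal{T}_S^k\cup\mathcal{T}_P^k$; $\mathcal{H}^{k+1}=\mathcal{H}^k\cup\mathcal{T}^k$; $x^{k+1}=t^k$; $\delta^{k+1}=\delta^k/\tau$ if $t^k\ne x^k$ and $\delta^{k+1}=\tau\delta^k$ otherwise; $\underline{\delta}^{k+1}=\min\{\underline{\delta}^k,\delta^{k+1}\}$. A run is an infinite execution in which all the prescribed choices exist (in particular every $\operatorname{argmin} f(\mathcal{T}_C^k)$, including for $k=0$, is nonempty). An infinite set $K^*\subseteq\mathbb{N}$ indexes a refining subsequence if $x^{k+1}=x^k$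 for all $k\in K^*$, $(\delta^k)_{k\in K^*}$ converges to $0$, and $(x^k)_{k\in K^*}$ converges to a point $x^*$, called the refined point. $\mathcal{R}$ is the set of all refined points over all refining subsequences of the run, and $\mathcal{H}=\bigcup_{k\in\mathbb{N}}\mathcal{H}^k$. *)

theory Defs
  imports "HOL-Analysis.Analysis"
begin

text \<open>
  The norm on \<open>real ^ 'n\<close> is an arbitrary one, so that balls, distances and nearest points
  carry it as a parameter \<open>N\<close>; the library's \<open>norm\<close> is the Euclidean one. Closure and
  compactness are those of the usual topology, which every norm induces.
\<close>

definition is_norm :: "(real ^ 'n \<Rightarrow> real) \<Rightarrow> bool" where
  "is_norm N \<longleftrightarrow>
     (\<forall>x. 0 \<le> N x) \<and> (\<forall>x. N x = 0 \<longleftrightarrow> x = 0) \<and>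
     (\<forall>a x. N (a *\<^sub>R x) = \<bar>a\<bar> * N x) \<and> (\<forall>x y. N (x + y) \<le> N x + N y)"

definition nball :: "(real ^ 'n \<Rightarrow> real) \<Rightarrow> real ^ 'n \<Rightarrow> real \<Rightarrow> (real ^ 'n) set" where
  "nball N x r = {y. N (y - x) < r}"

definition ndist :: "(real ^ 'n \<Rightarrow> real) \<Rightarrow> real ^ 'n \<Rightarrow> (real ^ 'n) set \<Rightarrow> real" where
  "ndist N x S = (INF s\<in>S. N (x - s))"

definition nearest :: "(real ^ 'n \<Rightarrow> real) \<Rightarrow> real ^ 'n \<Rightarrow> (real ^ 'n) set \<Rightarrow> (real ^ 'n) set" where
  "nearest N x S = {s \<in> S. \<forall>s'\<in>S. N (x - s) \<le> N (x - s')}"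

definition round_set :: "(real ^ 'n \<Rightarrow> real) \<Rightarrow> (real ^ 'n) set \<Rightarrow> (real ^ 'n) set \<Rightarrow> (real ^ 'n) set" where
  "round_set N A S = (\<Union>a\<in>A. nearest N a S)"

definition nonneg_combs :: "(real ^ 'n) set \<Rightarrow> (real ^ 'n) set" where
  "nonneg_combs D = {\<Sum>d\<in>F. c d *\<^sub>R d | F c. finite F \<and> F \<subseteq> D \<and> (\<forall>d\<in>F. 0 \<le> c d)}"

definition positive_basis :: "(real ^ 'n) set \<Rightarrow> bool" where
  "positive_basis D \<longleftrightarrow> nonneg_combs D = UNIV \<and> (\<forall>D'. D' \<subset> D \<longrightarrow> nonneg_combs D' \<noteq> UNIV)"

text \<open>
  Both suprema below are maxima, since a continuous function is maximised over a nonempty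
  compact set. Nothing is required of the value of the oracle at an empty \<open>S\<close>.
\<close>

definition covering_oracle ::
  "(real ^ 'n \<Rightarrow> real) \<Rightarrow> real \<Rightarrow> (real ^ 'n \<Rightarrow> (real ^ 'n) set \<Rightarrow> (real ^ 'n) set) \<Rightarrow> bool" where
  "covering_oracle N r orc \<longleftrightarrow>
     (\<exists>\<beta>. 0 < \<beta> \<and> \<beta> \<le> 1 \<and>
       (\<forall>x S. S \<noteq> {} \<longrightarrow>
          compact (orc x S) \<and> orc x S \<noteq> {} \<and> orc x S \<subseteq> closure (nball N 0 r) \<and>
          (SUP d\<in>orc x S. ndist N (x + d) S)
            \<ge> \<beta> * (SUP d\<in>closure (nball N 0 r). ndist N (x + d) S)))"

text \<open>
  The data of an execution. Components belonging to a step that is skipped at iteration \<open>k\<close>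
  (such as \<open>poll_dirs R k\<close> after a successful search) are left unconstrained, except that
  the corresponding set of trial points is empty.
\<close>

record 'a cdsm =
  tau :: real
  mesh :: "real \<Rightarrow> 'a set"
  decr :: "real \<Rightarrow> real"
  iter :: "nat \<Rightarrow> 'a"
  radius :: "nat \<Rightarrow> real"
  min_radius :: "nat \<Rightarrow> real"
  history :: "nat \<Rightarrow> 'a set"
  cover_dirs :: "nat \<Rightarrow> 'a set"
  search_dirs :: "nat \<Rightarrow> 'a set"
  poll_dirs :: "nat \<Rightarrow> 'a set"
  cover_trials :: "nat \<Rightarrow> 'a set"
  search_trials :: "nat \<Rightarrow> 'a set"
  poll_trials :: "nat \<Rightarrow> 'a set"
  cover_best :: "nat \<Rightarrow> 'a"
  search_best :: "nat \<Rightarrow> 'a"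
  poll_best :: "nat \<Rightarrow> 'a"
  chosen :: "nat \<Rightarrow> 'a"

definition mesh_based :: "real \<Rightarrow> (real \<Rightarrow> (real ^ 'n) set) \<Rightarrow> (real \<Rightarrow> real) \<Rightarrow> bool" where
  "mesh_based \<delta>0 M \<rho> \<longleftrightarrow>
     (\<forall>\<nu>\<ge>0. M \<nu> = (\<lambda>z. min \<nu> (\<nu>\<^sup>2 / \<delta>0) *\<^sub>R z) ` {z. \<forall>i. z $ i \<in> \<int>} \<and> \<rho> \<nu> = 0)"

definition decrease_based :: "real \<Rightarrow> (real \<Rightarrow> (real ^ 'n) set) \<Rightarrow> (real \<Rightarrow> real) \<Rightarrow> bool" where
  "decrease_based \<delta>0 M \<rho> \<longleftrightarrow> (\<forall>\<nu>\<ge>0. M \<nu> = UNIV \<and> \<rho> \<nu> = min \<nu> (\<nu>\<^sup>2 / \<delta>0))"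

definition cdsm_init :: "(real ^ 'n \<Rightarrow> ereal) \<Rightarrow> (real ^ 'n) cdsm \<Rightarrow> bool" where
  "cdsm_init f R \<longleftrightarrow>
     history R 0 = {} \<and> f (iter R 0) \<noteq> \<infinity> \<and>
     0 < radius R 0 \<and> min_radius R 0 = radius R 0 \<and>
     0 < tau R \<and> tau R < 1 \<and> tau R \<in> \<rat> \<and>
     (mesh_based (radius R 0) (mesh R) (decr R) \<or> decrease_based (radius R 0) (mesh R) (decr R))"

definition improves :: "(real ^ 'n \<Rightarrow> ereal) \<Rightarrow> (real ^ 'n) cdsm \<Rightarrow> nat \<Rightarrow> real ^ 'n \<Rightarrow> bool" where
  "improves f R k t \<longleftrightarrow> f t < f (iter R k) - ereal (decr R (min_radius R k))"

definition cdsm_poll ::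
  "(real ^ 'n \<Rightarrow> real) \<Rightarrow> (real ^ 'n \<Rightarrow> ereal) \<Rightarrow> (real ^ 'n) cdsm \<Rightarrow> nat \<Rightarrow> bool" where
  "cdsm_poll N f R k \<longleftrightarrow>
     poll_dirs R k \<subseteq> mesh R (min_radius R k) \<inter> closure (nball N 0 (radius R k)) \<and>
     positive_basis (poll_dirs R k) \<and>
     poll_trials R k = (+) (iter R k) ` poll_dirs R k \<and>
     is_arg_min f (\<lambda>t. t \<in> poll_trials R k) (poll_best R k) \<and>
     chosen R k = (if improves f R k (poll_best R k) then poll_best R k else iter R k)"

definition cdsm_search ::
  "(real ^ 'n \<Rightarrow> real) \<Rightarrow> (real ^ 'n \<Rightarrow> ereal) \<Rightarrow> (real ^ 'n) cdsm \<Rightarrow> nat \<Rightarrow> bool" where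
  "cdsm_search N f R k \<longleftrightarrow>
     search_dirs R k \<subseteq> mesh R (min_radius R k) \<and> finite (search_dirs R k) \<and>
     search_trials R k = (+) (iter R k) ` search_dirs R k \<and>
     (search_trials R k \<noteq> {} \<longrightarrow>
        is_arg_min f (\<lambda>t. t \<in> search_trials R k) (search_best R k)) \<and>
     (if search_trials R k \<noteq> {} \<and> improves f R k (search_best R k)
      then chosen R k = search_best R k \<and> poll_trials R k = {}
      else cdsm_poll N f R k)"

definition cdsm_cover ::
  "(real ^ 'n \<Rightarrow> real) \<Rightarrow> (real ^ 'n \<Rightarrow> ereal) \<Rightarrow> (real ^ 'n) cdsm \<Rightarrow> nat \<Rightarrow> bool" where
  "cdsm_cover N f R k \<longleftrightarrow>
     cover_trials R k = (+) (iter R k) ` cover_dirs R k \<and>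
     is_arg_min f (\<lambda>t. t \<in> cover_trials R k) (cover_best R k) \<and>
     (if improves f R k (cover_best R k)
      then chosen R k = cover_best R k \<and> search_trials R k = {} \<and> poll_trials R k = {}
      else cdsm_search N f R k)"

definition cdsm_update :: "(real ^ 'n) cdsm \<Rightarrow> nat \<Rightarrow> bool" where
  "cdsm_update R k \<longleftrightarrow>
     history R (Suc k) =
       history R k \<union> (cover_trials R k \<union> search_trials R k \<union> poll_trials R k) \<and>
     iter R (Suc k) = chosen R k \<and>
     radius R (Suc k) =
       (if chosen R k \<noteq> iter R k then radius R k / tau R else tau R * radius R k) \<and>
     min_radius R (Suc k) = min (min_radius R k) (radius R (Suc k))"

text \<open>
  No rule for choosing the covering directions is imposed here, only that the minimiser over
  the covering trial points exists.
\<close>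

definition cdsm_run ::
  "(real ^ 'n \<Rightarrow> real) \<Rightarrow> (real ^ 'n \<Rightarrow> ereal) \<Rightarrow> (real ^ 'n) cdsm \<Rightarrow> bool" where
  "cdsm_run N f R \<longleftrightarrow> cdsm_init f R \<and> (\<forall>k. cdsm_cover N f R k \<and> cdsm_update R k)"

definition refining :: "(real ^ 'n) cdsm \<Rightarrow> nat set \<Rightarrow> real ^ 'n \<Rightarrow> bool" where
  "refining R K p \<longleftrightarrow>
     infinite K \<and> (\<forall>k\<in>K. iter R (Suc k) = iter R k) \<and>
     (\<lambda>j. radius R (enumerate K j)) \<longlonglongrightarrow> 0 \<and>
     (\<lambda>j. iter R (enumerate K j)) \<longlonglongrightarrow> p"

definition refined_points :: "(real ^ 'n) cdsm \<Rightarrow> (real ^ 'n) set" where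
  "refined_points R = {p. \<exists>K. refining R K p}"

definition dense_covering :: "(real ^ 'n \<Rightarrow> real) \<Rightarrow> real \<Rightarrow> (real ^ 'n) cdsm \<Rightarrow> bool" where
  "dense_covering N r R \<longleftrightarrow>
     (\<forall>p\<in>refined_points R. nball N p r \<subseteq> closure (\<Union>k. history R k))"

end

theory Submission
  imports Defs
begin

text \<open>
  Suppose that a point \<open>y\<close> with \<open>N (y - p) < r\<close> stays at a distance at least \<open>e > 0\<close> from all
  trial points, where \<open>p\<close> is the limit of the iterates along a refining index set \<open>K\<close>. For late
  \<open>k \<in> K\<close> the point \<open>y\<close> lies in the ball of radius \<open>r\<close> around the iterate \<open>x\<^sup>k\<close>, so some point of
  that ball is \<open>e\<close>-far from the history, and the oracle must return a direction \<open>d\<close> for which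
  \<open>x\<^sup>k + d\<close> is \<open>\<beta> e / 2\<close>-far from the history (lemma \<open>covering_oracle_far_direction\<close>; the factor
  one half turns the supremum into a point that nearly attains it).

  Rounding moves \<open>d\<close> by at most a constant times the current minimal radius (lemma
  \<open>cdsm_rounding_error\<close>), which vanishes along \<open>K\<close>. So the covering step of every late
  \<open>k \<in> K\<close> evaluates a point at a distance at least \<open>\<beta> e / 4\<close> from everything evaluated before,
  in particular from the points so obtained at smaller indices of \<open>K\<close>. These points are bounded
  because the iterates converge along \<open>K\<close>, and a bounded sequence in a finite-dimensional space
  has no uniformly separated terms (lemma \<open>bounded_sequence_not_separated\<close>). This is
  a contradiction.
\<close>

section \<open>Norms on a finite-dimensional space\<close>

lemma
  assumes "is_norm N"
  shows is_norm_ge_0: "0 \<le> N x"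
    and is_norm_eq_0: "N x = 0 \<longleftrightarrow> x = 0"
    and is_norm_scaleR: "N (a *\<^sub>R x) = \<bar>a\<bar> * N x"
    and is_norm_triangle: "N (x + y) \<le> N x + N y"
  using assms unfolding is_norm_def by blast+

lemma is_norm_minus_commute:
  assumes "is_norm N"
  shows "N (x - y) = N (y - x)"
  using is_norm_scaleR[OF assms, of "-1" "x - y"] by simp

lemma is_norm_triangle_via:
  assumes "is_norm N"
  shows "N (x - z) \<le> N (x - y) + N (y - z)"
  using is_norm_triangle[OF assms, of "x - y" "y - z"] by simp

lemma continuous_on_is_norm:
  fixes N :: "real ^ 'n \<Rightarrow> real"
  assumes "is_norm N"
  shows "continuous_on UNIV N"
proof (rule convex_on_continuous)
  show "convex_on UNIV N"
  proof (rule convex_onI)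
    fix t :: real and x y :: "real ^ 'n"
    assume "0 < t" "t < 1"
    then show "N ((1 - t) *\<^sub>R x + t *\<^sub>R y) \<le> (1 - t) * N x + t * N y"
      using is_norm_triangle[OF assms, of "(1 - t) *\<^sub>R x" "t *\<^sub>R y"]
      by (simp add: is_norm_scaleR[OF assms])
  qed simp
qed simp

text \<open>
  The continuous function \<open>N\<close> is bounded on the compact Euclidean unit sphere, also away from
  \<open>0\<close>; homogeneity carries both bounds over to the whole space.
\<close>

lemma is_norm_equivalent_norm:
  fixes N :: "real ^ 'n \<Rightarrow> real"
  assumes "is_norm N"
  obtains c C where "0 < c" "0 < C" "\<And>x. c * norm x \<le> N x" "\<And>x. N x \<le> C * norm x"
proof -
  let ?U = "sphere 0 1 :: (real ^ 'n) set"
  have cont: "continuous_on ?U N"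
    using continuous_on_is_norm[OF assms] by (rule continuous_on_subset) simp
  have "compact ?U" "?U \<noteq> {}" by simp_all
  then obtain u v where u: "u \<in> ?U" "\<And>x. x \<in> ?U \<Longrightarrow> N u \<le> N x"
    and v: "v \<in> ?U" "\<And>x. x \<in> ?U \<Longrightarrow> N x \<le> N v"
    using continuous_attains_inf[OF _ _ cont] continuous_attains_sup[OF _ _ cont] by metis
  have pos: "0 < N w" if "w \<in> ?U" for w
  proof -
    have "w \<noteq> 0" using that by auto
    then show ?thesis
      using is_norm_ge_0[OF assms, of w] is_norm_eq_0[OF assms, of w] by linarith
  qed
  have bounds: "N u * norm x \<le> N x \<and> N x \<le> N v * norm x" for x
  proof (cases "x = 0")
    case True
    then show ?thesis using is_norm_eq_0[OF assms, of x] by simp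
  next
    case False
    let ?w = "inverse (norm x) *\<^sub>R x"
    have "?w \<in> ?U" using False by simp
    then have "N u \<le> N ?w" "N ?w \<le> N v" using u(2) v(2) by blast+
    then show ?thesis using False by (simp add: is_norm_scaleR[OF assms] field_simps)
  qed
  show thesis
    using that[of "N u" "N v"] bounds pos u(1) v(1) by blast
qed

lemma closure_nball_le:
  assumes "is_norm N" and "d \<in> closure (nball N x r)"
  shows "N (d - x) \<le> r"
proof -
  have "continuous_on UNIV (\<lambda>y. N (y - x))"
    by (rule continuous_on_compose2[OF continuous_on_is_norm[OF assms(1)]])
       (auto intro!: continuous_intros)
  then have "closed {y. N (y - x) \<le> r}"
    by (intro closed_Collect_le continuous_intros)
  then have "closure (nball N x r) \<subseteq> {y. N (y - x) \<le> r}"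
    by (intro closure_minimal) (auto simp: nball_def)
  then show ?thesis using assms(2) by blast
qed

lemma bounded_sequence_not_separated:
  fixes h :: "nat \<Rightarrow> real ^ 'n"
  assumes N: "is_norm N" and "bounded (range h)" and "0 < e"
  shows "\<exists>i j. i < j \<and> N (h j - h i) < e"
proof -
  obtain C where C: "0 < C" "\<And>x. N x \<le> C * norm x"
    using is_norm_equivalent_norm[OF N] by metis
  obtain l s where s: "strict_mono s" and "(h \<circ> s) \<longlonglongrightarrow> l"
    using bounded_imp_convergent_subsequence[OF assms(2)] by blast
  then have "Cauchy (h \<circ> s)" by (blast intro: LIMSEQ_imp_Cauchy)
  then obtain M where M: "\<And>m n. m \<ge> M \<Longrightarrow> n \<ge> M \<Longrightarrow> dist ((h \<circ> s) m) ((h \<circ> s) n) < e / C"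
    using C(1) \<open>0 < e\<close> unfolding Cauchy_def by (meson divide_pos_pos)
  have "norm (h (s (Suc M)) - h (s M)) < e / C"
    using M[of "Suc M" M] by (simp add: dist_norm)
  then have "C * norm (h (s (Suc M)) - h (s M)) < e"
    using C(1) by (simp add: field_simps)
  then have "N (h (s (Suc M)) - h (s M)) < e"
    using C(2) by (rule le_less_trans[rotated])
  moreover have "s M < s (Suc M)" using s by (simp add: strict_monoD)
  ultimately show ?thesis by blast
qed

section \<open>Nearest points and rounding\<close>

lemma ndist_le:
  assumes "is_norm N" and "s \<in> S"
  shows "ndist N x S \<le> N (x - s)"
  unfolding ndist_def using assms(2)
  by (intro cINF_lower bdd_belowI2[where m = 0]) (simp_all add: is_norm_ge_0[OF assms(1)])

lemma nearest_nonempty: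
  assumes N: "is_norm N" and "closed S" and "S \<noteq> {}"
  shows "nearest N x S \<noteq> {}"
proof -
  obtain c where c: "0 < c" "\<And>x. c * norm x \<le> N x"
    using is_norm_equivalent_norm[OF N] by metis
  obtain s0 where "s0 \<in> S" using \<open>S \<noteq> {}\<close> by blast
  \<comment> \<open>Outside this compact part of \<open>S\<close> every point is farther from \<open>x\<close> than \<open>s0\<close>.\<close>
  define T where "T = S \<inter> cball x (N (x - s0) / c)"
  have near: "s \<in> T" if "s \<in> S" "N (x - s) \<le> N (x - s0)" for s
  proof -
    have "c * norm (x - s) \<le> N (x - s0)" using c(2) that(2) by (rule order_trans)
    then show ?thesis
      using that(1) c(1) by (simp add: T_def dist_norm field_simps)
  qed
  have "compact T" unfolding T_def using \<open>closed S\<close> by (intro closed_Int_compact) simp_all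
  moreover have "T \<noteq> {}" using near[OF \<open>s0 \<in> S\<close>] by blast
  moreover have "continuous_on T (\<lambda>s. N (x - s))"
    by (rule continuous_on_compose2[OF continuous_on_is_norm[OF N]])
       (auto intro!: continuous_intros)
  ultimately obtain t where t: "t \<in> T" "\<And>s. s \<in> T \<Longrightarrow> N (x - t) \<le> N (x - s)"
    using continuous_attains_inf by metis
  have "N (x - t) \<le> N (x - s)" if "s \<in> S" for s
    using t(2)[of s] t(2)[OF near[OF \<open>s0 \<in> S\<close>]] near[OF that] by force
  then have "t \<in> nearest N x S" using t(1) by (auto simp: nearest_def T_def)
  then show ?thesis by blast
qed

lemma closed_scaled_integer_lattice:
  fixes a :: real
  shows "closed ((\<lambda>z. a *\<^sub>R z) ` {z :: real ^ 'n. \<forall>i. z $ i \<in> \<int>})"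
proof (rule closed_scaling)
  have "{z :: real ^ 'n. \<forall>i. z $ i \<in> \<int>} = (\<Inter>i. (\<lambda>z. z $ i) -` \<int>)" by auto
  moreover have "closed \<dots>"
    by (intro closed_INT ballI continuous_closed_vimage closed_Ints) (simp add: continuous_intros)
  ultimately show "closed {z :: real ^ 'n. \<forall>i. z $ i \<in> \<int>}" by simp
qed

lemma scaled_integer_lattice_approx:
  fixes x :: "real ^ 'n" and a :: real
  assumes "0 < a"
  shows "\<exists>z. (\<forall>i. z $ i \<in> \<int>) \<and> norm (x - a *\<^sub>R z) \<le> real CARD('n) * a"
proof (intro exI conjI)
  let ?z = "(\<chi> i. of_int \<lfloor>x $ i / a\<rfloor>) :: real ^ 'n"
  show "\<forall>i. ?z $ i \<in> \<int>" by simp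
  have "\<bar>(x - a *\<^sub>R ?z) $ i\<bar> \<le> a" for i
  proof -
    have "(x - a *\<^sub>R ?z) $ i = a * frac (x $ i / a)"
      using assms by (simp add: frac_def algebra_simps)
    moreover have "0 \<le> frac (x $ i / a)" "frac (x $ i / a) \<le> 1"
      using frac_lt_1[of "x $ i / a"] by simp_all
    ultimately show ?thesis using assms by (simp add: abs_mult mult_le_cancel_left1)
  qed
  then have "(\<Sum>i\<in>UNIV. \<bar>(x - a *\<^sub>R ?z) $ i\<bar>) \<le> real CARD('n) * a"
    by (intro sum_bounded_above) simp
  then show "norm (x - a *\<^sub>R ?z) \<le> real CARD('n) * a"
    by (rule order_trans[OF norm_le_l1_cart])
qed

text \<open>
  Under both options and for \<open>\<nu> > 0\<close>, the set \<open>M \<nu>\<close> is closed and meets every ball whose radius is a fixed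
  multiple of \<open>\<nu>\<close>: the mesh has step at most \<open>\<nu>\<close>.
\<close>

lemma cdsm_rounding_error:
  fixes N :: "real ^ 'n \<Rightarrow> real"
  assumes N: "is_norm N" and "0 < \<delta>0"
    and M: "mesh_based \<delta>0 M \<rho> \<or> decrease_based \<delta>0 M \<rho>"
  obtains C where "0 < C"
    "\<And>\<nu> d. 0 < \<nu> \<Longrightarrow> \<exists>d'\<in>nearest N d (M \<nu>). N (d - d') \<le> C * \<nu>"
proof -
  obtain B where B: "0 < B" "\<And>x. N x \<le> B * norm x"
    using is_norm_equivalent_norm[OF N] by metis
  let ?C = "B * real CARD('n)"
  have "\<exists>d'\<in>nearest N d (M \<nu>). N (d - d') \<le> ?C * \<nu>" if "0 < \<nu>" for \<nu> d
  proof -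
    have "closed (M \<nu>) \<and> (\<exists>s\<in>M \<nu>. N (d - s) \<le> ?C * \<nu>)"
      using M
    proof
      assume "decrease_based \<delta>0 M \<rho>"
      then have "M \<nu> = UNIV" using that by (simp add: decrease_based_def)
      moreover have "N (d - d) \<le> ?C * \<nu>"
        using is_norm_eq_0[OF N, of 0] B(1) that by simp
      ultimately show ?thesis by (metis UNIV_I closed_UNIV)
    next
      assume mb: "mesh_based \<delta>0 M \<rho>"
      define a where "a = min \<nu> (\<nu>\<^sup>2 / \<delta>0)"
      have a: "0 < a" "a \<le> \<nu>" using that \<open>0 < \<delta>0\<close> by (simp_all add: a_def)
      have eq: "M \<nu> = (\<lambda>z. a *\<^sub>R z) ` {z. \<forall>i. z $ i \<in> \<int>}"
        using mb that by (simp add: mesh_based_def a_def)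
      obtain z where z: "\<forall>i. z $ i \<in> \<int>" "norm (d - a *\<^sub>R z) \<le> real CARD('n) * a"
        using scaled_integer_lattice_approx[OF a(1)] by blast
      have "norm (d - a *\<^sub>R z) \<le> real CARD('n) * \<nu>"
        using z(2) a(2) by (meson mult_left_mono of_nat_0_le_iff order_trans)
      then have "B * norm (d - a *\<^sub>R z) \<le> ?C * \<nu>"
        using B(1) by (simp add: mult.assoc)
      then have "N (d - a *\<^sub>R z) \<le> ?C * \<nu>"
        using B(2) order_trans by blast
      moreover have "closed (M \<nu>)" unfolding eq by (rule closed_scaled_integer_lattice)
      moreover have "a *\<^sub>R z \<in> M \<nu>" unfolding eq using z(1) by blast
      ultimately show ?thesis by blast
    qed
    then obtain s where s: "closed (M \<nu>)" "s \<in> M \<nu>" "N (d - s) \<le> ?C * \<nu>" by blast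
    then obtain d' where d': "d' \<in> nearest N d (M \<nu>)"
      using nearest_nonempty[OF N] by blast
    then have "N (d - d') \<le> N (d - s)" using s(2) by (simp add: nearest_def)
    then show ?thesis using d' s(3) by (blast intro: order_trans)
  qed
  moreover have "0 < ?C" using B(1) by simp
  ultimately show thesis using that by blast
qed

section \<open>Directions returned by a covering oracle\<close>

text \<open>
  A point \<open>y\<close> of the ball that is \<open>e\<close>-far from \<open>S\<close> makes the covering supremum at least \<open>e\<close>,
  so the supremum over the oracle's directions is at least \<open>\<beta> e\<close>, and some direction comes
  within a factor one half of it. One constant serves all \<open>x\<close>, \<open>S\<close>, \<open>y\<close> and \<open>e\<close>, so that it is the same at every
  iteration.
\<close>

lemma covering_oracle_far_direction:
  fixes N :: "real ^ 'n \<Rightarrow> real"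
  assumes N: "is_norm N" and "covering_oracle N r orc"
  obtains b where "0 < b"
    "\<And>x S y e. \<lbrakk>S \<noteq> {}; N (y - x) < r; 0 < e; \<And>s. s \<in> S \<Longrightarrow> e \<le> N (y - s)\<rbrakk>
       \<Longrightarrow> \<exists>d\<in>orc x S. N d \<le> r \<and> (\<forall>s\<in>S. b * e \<le> N (x + d - s))"
proof -
  let ?B = "closure (nball N 0 r)"
  obtain \<beta> where "0 < \<beta>" and axioms: "\<forall>x S. S \<noteq> {} \<longrightarrow>
      compact (orc x S) \<and> orc x S \<noteq> {} \<and> orc x S \<subseteq> ?B \<and>
      \<beta> * (SUP d\<in>?B. ndist N (x + d) S) \<le> (SUP d\<in>orc x S. ndist N (x + d) S)"
    using assms(2) unfolding covering_oracle_def by (elim exE conjE)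
  have orc: "\<And>x S. S \<noteq> {} \<Longrightarrow>
      orc x S \<noteq> {} \<and> orc x S \<subseteq> ?B \<and>
      \<beta> * (SUP d\<in>?B. ndist N (x + d) S) \<le> (SUP d\<in>orc x S. ndist N (x + d) S)"
    using axioms by simp
  have ball: "N d \<le> r" if "d \<in> ?B" for d
    using closure_nball_le[OF N that] by simp
  have "\<exists>d\<in>orc x S. N d \<le> r \<and> (\<forall>s\<in>S. \<beta> / 2 * e \<le> N (x + d - s))"
    if S: "S \<noteq> {}" and y: "N (y - x) < r" and "0 < e" and far: "\<And>s. s \<in> S \<Longrightarrow> e \<le> N (y - s)"
    for x y :: "real ^ 'n" and S e
  proof -
    let ?g = "\<lambda>d. ndist N (x + d) S"
    obtain s0 where "s0 \<in> S" using S by blast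
    have "?g d \<le> N (x - s0) + r" if "d \<in> ?B" for d
      using ndist_le[OF N \<open>s0 \<in> S\<close>, of "x + d"] is_norm_triangle[OF N, of "x - s0" d]
        ball[OF that] by (simp add: algebra_simps)
    then have bdd: "bdd_above (?g ` ?B)" by (rule bdd_aboveI2)
    have "e \<le> ?g (y - x)"
      unfolding ndist_def using S far by (intro cINF_greatest) simp_all
    also have "y - x \<in> ?B"
      using y by (intro subsetD[OF closure_subset]) (simp add: nball_def)
    then have "?g (y - x) \<le> (SUP d\<in>?B. ?g d)" using bdd by (rule cSUP_upper)
    finally have "\<beta> * e \<le> \<beta> * (SUP d\<in>?B. ?g d)" using \<open>0 < \<beta>\<close> by simp
    moreover have "\<beta> / 2 * e < \<beta> * e" using \<open>0 < \<beta>\<close> \<open>0 < e\<close> by simp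
    ultimately have "\<beta> / 2 * e < (SUP d\<in>orc x S. ?g d)" using orc[OF S, of x] by linarith
    moreover have "bdd_above (?g ` orc x S)"
      using bdd orc[OF S] by (meson bdd_above_mono image_mono)
    ultimately obtain d where d: "d \<in> orc x S" "\<beta> / 2 * e < ?g d"
      using less_cSUP_iff orc[OF S] by meson
    then have "\<beta> / 2 * e \<le> N (x + d - s)" if "s \<in> S" for s
      using ndist_le[OF N that, of "x + d"] by linarith
    moreover have "N d \<le> r" using d(1) orc[OF S] ball by blast
    ultimately show ?thesis using d(1) by blast
  qed
  then show thesis using that[of "\<beta> / 2"] \<open>0 < \<beta>\<close> by simp
qed

section \<open>Radii and histories of a run\<close>

lemma cdsm_run_radius_pos:
  assumes "cdsm_run N f R"
  shows "0 < radius R k"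
proof (induction k)
  case 0
  then show ?case using assms by (simp add: cdsm_run_def cdsm_init_def)
next
  case (Suc k)
  have "0 < tau R" "cdsm_update R k"
    using assms by (simp_all add: cdsm_run_def cdsm_init_def)
  then show ?case using Suc by (simp add: cdsm_update_def)
qed

lemma cdsm_run_min_radius_pos:
  assumes "cdsm_run N f R"
  shows "0 < min_radius R k"
proof (induction k)
  case 0
  then show ?case using assms by (simp add: cdsm_run_def cdsm_init_def)
next
  case (Suc k)
  have "min_radius R (Suc k) = min (min_radius R k) (radius R (Suc k))"
    using assms by (simp add: cdsm_run_def cdsm_update_def)
  then show ?case using Suc cdsm_run_radius_pos[OF assms, of "Suc k"] by simp
qed

lemma cdsm_run_min_radius_le:
  assumes "cdsm_run N f R"
  shows "min_radius R k \<le> radius R k"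
proof (cases k)
  case 0
  then show ?thesis using assms by (simp add: cdsm_run_def cdsm_init_def)
next
  case (Suc j)
  then show ?thesis using assms by (simp add: cdsm_run_def cdsm_update_def)
qed

lemma cdsm_run_history_mono:
  assumes "cdsm_run N f R" and "i \<le> j"
  shows "history R i \<subseteq> history R j"
  by (rule lift_Suc_mono_le[OF _ assms(2)])
     (use assms(1) in \<open>auto simp: cdsm_run_def cdsm_update_def\<close>)

lemma cdsm_run_cover_trials_in_history:
  assumes "cdsm_run N f R" and "d \<in> cover_dirs R k"
  shows "iter R k + d \<in> history R (Suc k)"
  using assms by (auto simp: cdsm_run_def cdsm_update_def cdsm_cover_def)

text \<open>
  The oracle is controlled at nonempty sets only, so it has to be known when the history is one.
  The first covering step already evaluates a point, because a minimiser over its trial points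
  exists.
\<close>

lemma cdsm_run_history_nonempty:
  assumes "cdsm_run N f R" and "0 < k"
  shows "history R k \<noteq> {}"
proof -
  have "cover_best R 0 \<in> history R (Suc 0)"
    using assms(1) by (auto simp: cdsm_run_def cdsm_update_def cdsm_cover_def is_arg_min_def)
  then show ?thesis
    using cdsm_run_history_mono[OF assms(1), of "Suc 0" k] assms(2) by auto
qed

section \<open>The dense covering property\<close>

text \<open>
  The far direction of the oracle survives rounding: by the triangle inequality the rounded
  trial point, which joins the history, loses at most the rounding error \<open>C \<nu>\<close> both in its
  distance from the older points and in its closeness to the iterate.
\<close>

lemma covering_step_far_trial:
  fixes N :: "real ^ 'n \<Rightarrow> real"
  assumes N: "is_norm N" and orc: "covering_oracle N r orc" and run: "cdsm_run N f R"
    and dirs: "\<And>k. cover_dirs R k =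
           round_set N (orc (iter R k) (history R k)) (mesh R (min_radius R k))"
  obtains b C where "0 < b" "0 < C"
    "\<And>k y e. \<lbrakk>0 < k; N (y - iter R k) < r; 0 < e; \<And>s. s \<in> history R k \<Longrightarrow> e \<le> N (y - s)\<rbrakk>
       \<Longrightarrow> \<exists>h\<in>history R (Suc k). N (h - iter R k) \<le> r + C * min_radius R k \<and>
             (\<forall>s\<in>history R k. b * e - C * min_radius R k \<le> N (h - s))"
proof -
  obtain b where b: "0 < b"
    "\<And>x S y e. \<lbrakk>S \<noteq> {}; N (y - x) < r; 0 < e; \<And>s. s \<in> S \<Longrightarrow> e \<le> N (y - s)\<rbrakk>
       \<Longrightarrow> \<exists>d\<in>orc x S. N d \<le> r \<and> (\<forall>s\<in>S. b * e \<le> N (x + d - s))"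
    using covering_oracle_far_direction[OF N orc] by blast
  have "0 < radius R 0"
    "mesh_based (radius R 0) (mesh R) (decr R) \<or> decrease_based (radius R 0) (mesh R) (decr R)"
    using run by (simp_all add: cdsm_run_def cdsm_init_def)
  then obtain C where C: "0 < C"
    "\<And>\<nu> d. 0 < \<nu> \<Longrightarrow> \<exists>d'\<in>nearest N d (mesh R \<nu>). N (d - d') \<le> C * \<nu>"
    using cdsm_rounding_error[OF N] by metis
  have "\<exists>h\<in>history R (Suc k). N (h - iter R k) \<le> r + C * min_radius R k \<and>
          (\<forall>s\<in>history R k. b * e - C * min_radius R k \<le> N (h - s))"
    if "0 < k" and hyps: "N (y - iter R k) < r" "0 < e"
      and far: "\<And>s. s \<in> history R k \<Longrightarrow> e \<le> N (y - s)"
    for k y e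
  proof -
    let ?x = "iter R k" and ?\<nu> = "min_radius R k"
    obtain d where d: "d \<in> orc ?x (history R k)" "N d \<le> r"
      and d_far: "\<And>s. s \<in> history R k \<Longrightarrow> b * e \<le> N (?x + d - s)"
      using b(2)[OF cdsm_run_history_nonempty[OF run \<open>0 < k\<close>] hyps far] by blast
    obtain d' where d': "d' \<in> nearest N d (mesh R ?\<nu>)" "N (d - d') \<le> C * ?\<nu>"
      using C(2)[OF cdsm_run_min_radius_pos[OF run]] by blast
    have "d' \<in> cover_dirs R k" unfolding dirs round_set_def using d(1) d'(1) by blast
    then have "?x + d' \<in> history R (Suc k)" by (rule cdsm_run_cover_trials_in_history[OF run])
    moreover have "N (?x + d' - ?x) \<le> r + C * ?\<nu>"
      using is_norm_triangle_via[OF N, of d' 0 d] is_norm_minus_commute[OF N, of d d'] d(2) d'(2)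
      by simp
    moreover have "b * e - C * ?\<nu> \<le> N (?x + d' - s)" if "s \<in> history R k" for s
      using is_norm_triangle_via[OF N, of "?x + d" s "?x + d'"] d_far[OF that] d'(2) by simp
    ultimately show ?thesis by blast
  qed
  then show thesis using that[OF b(1) C(1)] by blast
qed

theorem proposition3:
  fixes N :: "real ^ 'n \<Rightarrow> real"
    and f :: "real ^ 'n \<Rightarrow> ereal"
    and r :: real
    and orc :: "real ^ 'n \<Rightarrow> (real ^ 'n) set \<Rightarrow> (real ^ 'n) set"
    and R :: "(real ^ 'n) cdsm"
  assumes "is_norm N"
    and "\<And>x. f x \<noteq> - \<infinity>"
    and "0 < r"
    and "covering_oracle N r orc"
    and "cdsm_run N f R"
    and "\<And>k. cover_dirs R k =
           round_set N (orc (iter R k) (history R k)) (mesh R (min_radius R k))"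
  shows "dense_covering N r R"
  unfolding dense_covering_def
proof (intro ballI subsetI, rule ccontr)
  note N = assms(1) and run = assms(5)
  let ?H = "\<Union>k. history R k"
  fix p y
  assume "p \<in> refined_points R" and y: "y \<in> nball N p r" and notin: "y \<notin> closure ?H"
  then obtain K where K: "infinite K"
    and radius_lim: "(\<lambda>j. radius R (enumerate K j)) \<longlonglongrightarrow> 0"
    and iter_lim: "(\<lambda>j. iter R (enumerate K j)) \<longlonglongrightarrow> p"
    by (auto simp: refined_points_def refining_def)
  let ?k = "enumerate K"
  let ?x = "\<lambda>j. iter R (?k j)" and ?\<nu> = "\<lambda>j. min_radius R (?k j)"
  obtain c where c: "0 < c" "\<And>x. c * norm x \<le> N x"
    using is_norm_equivalent_norm[OF N] by metis
  obtain b C where "0 < b" "0 < C" and trial: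
    "\<And>k y e. \<lbrakk>0 < k; N (y - iter R k) < r; 0 < e; \<And>s. s \<in> history R k \<Longrightarrow> e \<le> N (y - s)\<rbrakk>
       \<Longrightarrow> \<exists>h\<in>history R (Suc k). N (h - iter R k) \<le> r + C * min_radius R k \<and>
             (\<forall>s\<in>history R k. b * e - C * min_radius R k \<le> N (h - s))"
    using covering_step_far_trial[OF N assms(4) run assms(6)] by blast
  obtain \<epsilon> where "0 < \<epsilon>" and \<epsilon>: "\<And>s. s \<in> ?H \<Longrightarrow> \<epsilon> \<le> dist s y"
    using notin unfolding closure_approachable by (meson not_le)
  \<comment> \<open>The closure gives a Euclidean distance; \<open>c\<close> converts it to a distance for \<open>N\<close>.\<close>
  define e where "e = c * \<epsilon>"
  have "0 < e" using \<open>0 < c\<close> \<open>0 < \<epsilon>\<close> by (simp add: e_def)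
  have far: "e \<le> N (y - s)" if "s \<in> history R k" for s k
  proof -
    have "\<epsilon> \<le> norm (y - s)" using \<epsilon>[of s] that by (auto simp: dist_norm norm_minus_commute)
    then have "e \<le> c * norm (y - s)" using \<open>0 < c\<close> by (simp add: e_def)
    then show ?thesis using c(2) by (rule order_trans)
  qed
  \<comment> \<open>Half of the guaranteed distance \<open>b * e\<close> is left for the rounding error of late indices.\<close>
  define g where "g = b * e / 2"
  have "0 < g" using \<open>0 < b\<close> \<open>0 < e\<close> by (simp add: g_def)

  have "(\<lambda>j. N (y - ?x j)) \<longlonglongrightarrow> N (y - p)"
    by (rule continuous_on_tendsto_compose[OF continuous_on_is_norm[OF N]])
       (auto intro!: tendsto_intros iter_lim)
  then have "\<forall>\<^sub>F j in sequentially. N (y - ?x j) < r"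
    by (rule order_tendstoD) (use y in \<open>simp add: nball_def\<close>)
  moreover have "(\<lambda>j. C * radius R (?k j)) \<longlonglongrightarrow> C * 0"
    by (intro tendsto_intros radius_lim)
  then have "\<forall>\<^sub>F j in sequentially. C * radius R (?k j) < g"
    by (rule order_tendstoD) (use \<open>0 < g\<close> in simp)
  \<comment> \<open>The bound \<open>0 < j\<close> keeps the index \<open>enumerate K j\<close> away from \<open>0\<close>, where the history is empty.\<close>
  ultimately have "\<forall>\<^sub>F j in sequentially. N (y - ?x j) < r \<and> C * radius R (?k j) < g \<and> 0 < j"
    using eventually_gt_at_top[of 0] by eventually_elim blast
  then obtain J where J: "\<And>j. J \<le> j \<Longrightarrow> N (y - ?x j) < r \<and> C * radius R (?k j) < g \<and> 0 < j"
    unfolding eventually_sequentially by blast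
  have "\<exists>h\<in>history R (Suc (?k (J + j))). N (h - ?x (J + j)) \<le> r + g \<and>
          (\<forall>s\<in>history R (?k (J + j)). g \<le> N (h - s))" for j
  proof -
    let ?j = "J + j"
    have pos: "0 < ?k ?j" using le_enumerate[OF K, of ?j] J[of ?j] by linarith
    have "N (y - ?x ?j) < r" using J[of ?j] by simp
    from trial[OF pos this \<open>0 < e\<close> far[of _ "?k ?j"]]
    obtain h where h: "h \<in> history R (Suc (?k ?j))" "N (h - ?x ?j) \<le> r + C * ?\<nu> ?j"
      "\<And>s. s \<in> history R (?k ?j) \<Longrightarrow> b * e - C * ?\<nu> ?j \<le> N (h - s)"
      by blast
    have "C * ?\<nu> ?j \<le> C * radius R (?k ?j)"
      using cdsm_run_min_radius_le[OF run] \<open>0 < C\<close> by simp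
    then have "C * ?\<nu> ?j < g" using J[of ?j] by simp
    moreover have "b * e = g + g" by (simp add: g_def)
    ultimately have "N (h - ?x ?j) \<le> r + g" "\<And>s. s \<in> history R (?k ?j) \<Longrightarrow> g \<le> N (h - s)"
      using h(2) h(3) by (linarith, force)
    then show ?thesis using h(1) by blast
  qed
  then obtain h where h: "\<And>j. h j \<in> history R (Suc (?k (J + j)))"
    and h_near: "\<And>j. N (h j - ?x (J + j)) \<le> r + g"
    and h_far: "\<And>j s. s \<in> history R (?k (J + j)) \<Longrightarrow> g \<le> N (h j - s)"
    by metis

  have "bounded (range h)"
  proof -
    obtain B where B: "\<And>j. norm (?x j) \<le> B"
      using convergent_imp_bounded[OF iter_lim] by (auto simp: bounded_iff)
    have "norm (h j) \<le> (r + g) / c + B" for j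
    proof -
      have "c * norm (h j - ?x (J + j)) \<le> r + g" using c(2) h_near by (rule order_trans)
      then have "norm (h j - ?x (J + j)) \<le> (r + g) / c" using \<open>0 < c\<close> by (simp add: field_simps)
      then show ?thesis
        using B[of "J + j"] norm_triangle_sub[of "h j" "?x (J + j)"] by linarith
    qed
    then show ?thesis by (auto simp: bounded_iff)
  qed
  then obtain i j where "i < j" "N (h j - h i) < g"
    using bounded_sequence_not_separated[OF N _ \<open>0 < g\<close>] by blast
  \<comment> \<open>The earlier of the two close points was in the history when the later one was chosen.\<close>
  moreover have "h i \<in> history R (?k (J + j))"
  proof -
    have "Suc (?k (J + i)) \<le> ?k (J + j)"
      using enumerate_mono[OF _ K, of "J + i" "J + j"] \<open>i < j\<close> by simp
    then show ?thesis using h[of i] cdsm_run_history_mono[OF run] by blast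
  qed
  ultimately show False using h_far[of "h i" j] by simp
qed

end
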